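(* Let $G$ be a finite group and let $N\unlhd G$ be such that $G$ is relative almost monomial with respect to $N$. Let $A\unlhd G$ be such that $A\subseteq N$. Then $G/A$ is relative almost monomial with respect to $N/A$.
   Context: All characters are complex characters of finite groups, and $\operatorname{Irr}(G)$ is the set of irreducible characters of $G$. For $H\leqslant G$, $\chi_H$ denotes restriction to $H$ and $\theta^G$ denotes induction from $H$ to $G$. For a character $\chi$ of $G$, $\operatorname{Cons}(\chi):=\{\phi\in\operatorname{Irr}(G):\langle\phi,\chi\rangle>0\}$ is its set of constituents. Let $G$ be a finite group and $N\unlhd G$. The group $G$ is called relative almost monomial with respect to $N$ if for any $\chi\neq\phi\in\operatorname{Irr}(G)$ there exist a subgroup $H$ with $N\subseteq H\leqslant G$ and $\psi\in\operatorname{Irr}(H)$ such that $\psi_N\in\operatorname{Irr}(N)$, $\chi\in\operatorname{Cons}(\psi^G)$ and $\phi\notin\operatorname{Cons}(\psi^G)$. *)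

theory Defs
  imports
    "HOL-Algebra.Coset"
    "Jordan_Normal_Form.VS_Connect"
begin

text \<open>Complex representations are matrix representations \<open>G \<rightarrow> GL\<^sub>n(\<complex>)\<close>. A subgroup \<open>H\<close> of \<open>G\<close>
  is treated as a group in its own right via the record \<open>G\<lparr>carrier := H\<rparr>\<close>.\<close>

definition GL :: "nat \<Rightarrow> complex mat monoid"
  where "GL n = units_of (ring_mat TYPE(complex) n ())"

definition matrix_representation ::
    "('a, 'b) monoid_scheme \<Rightarrow> nat \<Rightarrow> ('a \<Rightarrow> complex mat) \<Rightarrow> bool"
  where "matrix_representation G n \<rho> \<longleftrightarrow> \<rho> \<in> hom G (GL n)"

definition irreducible_rep ::
    "('a, 'b) monoid_scheme \<Rightarrow> nat \<Rightarrow> ('a \<Rightarrow> complex mat) \<Rightarrow> bool"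
  where "irreducible_rep G n \<rho> \<longleftrightarrow> matrix_representation G n \<rho> \<and> n > 0 \<and>
    (\<forall>W. VectorSpace.subspace class_ring W (module_vec TYPE(complex) n) \<and>
         (\<forall>g\<in>carrier G. \<forall>w\<in>W. \<rho> g *\<^sub>v w \<in> W)
       \<longrightarrow> W = {0\<^sub>v n} \<or> W = carrier_vec n)"

text \<open>Functions on a group are normalised to \<open>undefined\<close> outside its carrier, so that equality of
  characters is equality of functions on the group.\<close>

definition rep_character ::
    "('a, 'b) monoid_scheme \<Rightarrow> nat \<Rightarrow> ('a \<Rightarrow> complex mat) \<Rightarrow> 'a \<Rightarrow> complex"
  where "rep_character G n \<rho> = (\<lambda>g\<in>carrier G. \<Sum>i<n. \<rho> g $$ (i, i))"

definition Irr :: "('a, 'b) monoid_scheme \<Rightarrow> ('a \<Rightarrow> complex) set"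
  where "Irr G = {rep_character G n \<rho> | n \<rho>. irreducible_rep G n \<rho>}"

definition char_inner ::
    "('a, 'b) monoid_scheme \<Rightarrow> ('a \<Rightarrow> complex) \<Rightarrow> ('a \<Rightarrow> complex) \<Rightarrow> complex"
  where "char_inner G \<phi> \<chi> = (\<Sum>g\<in>carrier G. \<phi> g * cnj (\<chi> g)) / of_nat (card (carrier G))"

text \<open>The order on \<^typ>\<open>complex\<close> is the one of \<open>Complex_Order\<close>: \<open>0 < z\<close> means that \<open>z\<close> is real and
  positive.\<close>

definition constituents :: "('a, 'b) monoid_scheme \<Rightarrow> ('a \<Rightarrow> complex) \<Rightarrow> ('a \<Rightarrow> complex) set"
  where "constituents G \<chi> = {\<phi> \<in> Irr G. 0 < char_inner G \<phi> \<chi>}"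

text \<open>Induction of a class function \<open>\<theta>\<close> of \<open>H\<close>:
  \<open>\<theta>\<^sup>G(g) = 1/|H| \<Sum>x\<in>G. \<theta>\<degree>(x g x\<^sup>-\<^sup>1)\<close>, where \<open>\<theta>\<degree>\<close> extends \<open>\<theta>\<close> by zero outside \<open>H\<close>.\<close>

definition induced ::
    "('a, 'b) monoid_scheme \<Rightarrow> 'a set \<Rightarrow> ('a \<Rightarrow> complex) \<Rightarrow> 'a \<Rightarrow> complex"
  where "induced G H \<theta> = (\<lambda>g\<in>carrier G.
    (\<Sum>x\<in>carrier G.
       let y = x \<otimes>\<^bsub>G\<^esub> g \<otimes>\<^bsub>G\<^esub> inv\<^bsub>G\<^esub> x in if y \<in> H then \<theta> y else 0) / of_nat (card H))"

definition relative_almost_monomial :: "('a, 'b) monoid_scheme \<Rightarrow> 'a set \<Rightarrow> bool"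
  where "relative_almost_monomial G N \<longleftrightarrow>
    finite (carrier G) \<and> N \<lhd> G \<and>
    (\<forall>\<chi>\<in>Irr G. \<forall>\<phi>\<in>Irr G. \<chi> \<noteq> \<phi> \<longrightarrow>
      (\<exists>H \<psi>. subgroup H G \<and> N \<subseteq> H \<and> \<psi> \<in> Irr (G\<lparr>carrier := H\<rparr>) \<and>
        restrict \<psi> N \<in> Irr (G\<lparr>carrier := N\<rparr>) \<and>
        \<chi> \<in> constituents G (induced G H \<psi>) \<and> \<phi> \<notin> constituents G (induced G H \<psi>)))"

end

theory Submission
  imports Defs
begin

text \<open>
  The idea is to transport everything along the coset map: characters of \<open>G/A\<close> are the same thing
  as characters of \<open>G\<close> that are constant on \<open>A\<close>-cosets, via \<open>inflate\<close>. Inflation preserves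
  irreducibility (\<open>inflate_Irr\<close>) and inner products (\<open>char_inner_inflate\<close>), and it commutes with
  induction from a subgroup containing \<open>A\<close> (\<open>induced_inflate\<close>). So, given distinct irreducible
  characters of \<open>G/A\<close>, the pair \<open>(H, \<psi>)\<close> that separates their inflations yields a pair for \<open>G/A\<close>,
  provided that \<open>\<psi>\<close> is itself inflated from \<open>H/A\<close>, and its restriction to \<open>N\<close> from \<open>N/A\<close>.

  Both provisos come from one dichotomy (\<open>Irr_inflated_or_coset_sums_zero\<close>). The \<open>A\<close>-fixed vectors
  of an irreducible representation form an invariant subspace because \<open>A\<close> is normal, so they are
  everything or zero. In the first case \<open>A\<close> acts trivially and the character is inflated. In the
  second the operator \<open>\<Sum>\<^bsub>a\<in>A\<^esub> \<rho>(a)\<close>, whose values are fixed vectors, vanishes, and hence so do the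
  sums of the character over all \<open>A\<close>-cosets. If \<open>\<psi>\<close> were of the second kind, then the coset sums of
  \<open>\<psi>\<^sup>G\<close> would vanish as well, making \<open>\<psi>\<^sup>G\<close> orthogonal to every inflated character, whereas it has an
  inflated constituent by choice. Once \<open>\<psi>\<close> is inflated it takes its nonzero degree as value on all
  of \<open>A\<close>, which excludes the second kind for \<open>\<psi>\<^sub>N\<close>.
\<close>

section \<open>Matrix representations and their invariant subspaces\<close>

lemma group_GL: "Group.group (GL n)"
  unfolding GL_def
  by (intro monoid.units_group ring.is_monoid) (simp add: ring_mat)

lemma matrix_representation_carrier:
  "matrix_representation G n \<rho> \<Longrightarrow> g \<in> carrier G \<Longrightarrow> \<rho> g \<in> carrier_mat n n"
  by (auto simp: matrix_representation_def GL_def units_of_def Units_def ring_mat_simps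
      dest!: hom_in_carrier)

lemma matrix_representation_mult:
  "matrix_representation G n \<rho> \<Longrightarrow> g \<in> carrier G \<Longrightarrow> h \<in> carrier G \<Longrightarrow>
    \<rho> (g \<otimes>\<^bsub>G\<^esub> h) = \<rho> g * \<rho> h"
  by (simp add: matrix_representation_def GL_def units_of_def ring_mat_simps hom_mult)

lemma matrix_representation_one:
  assumes "Group.group G" "matrix_representation G n \<rho>"
  shows "\<rho> \<one>\<^bsub>G\<^esub> = 1\<^sub>m n"
proof -
  have "\<rho> \<one>\<^bsub>G\<^esub> = \<one>\<^bsub>GL n\<^esub>"
    using assms group_GL by (intro hom_one) (auto simp: matrix_representation_def)
  then show ?thesis
    by (simp add: GL_def units_of_def ring_mat_simps)
qed

lemma irreducible_rep_invariant_cases: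
  assumes "irreducible_rep G n \<rho>" and "W \<subseteq> carrier_vec n" and "0\<^sub>v n \<in> W"
    and "\<And>v w. v \<in> W \<Longrightarrow> w \<in> W \<Longrightarrow> v + w \<in> W"
    and "\<And>c w. w \<in> W \<Longrightarrow> c \<cdot>\<^sub>v w \<in> W"
    and "\<And>g w. g \<in> carrier G \<Longrightarrow> w \<in> W \<Longrightarrow> \<rho> g *\<^sub>v w \<in> W"
  shows "W = {0\<^sub>v n} \<or> W = carrier_vec n"
proof -
  have "LinearCombinations.submodule class_ring W (module_vec TYPE(complex) n)"
    using assms vec_vs[where 'a = complex and n = n]
    by (auto simp: LinearCombinations.submodule_def module_vec_simps vectorspace_def)
  then have "VectorSpace.subspace class_ring W (module_vec TYPE(complex) n)"
    by (simp add: subspace_def vec_vs)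
  then show ?thesis
    using assms(1,6) by (auto simp: irreducible_rep_def)
qed

section \<open>The coset map and inflation of characters\<close>

lemma quotient_of_subgroup:
  "(G Mod A)\<lparr>carrier := carrier (G\<lparr>carrier := H\<rparr> Mod A)\<rparr> = G\<lparr>carrier := H\<rparr> Mod A"
  by (simp add: FactGroup_def set_mult_def RCOSETS_def r_coset_def fun_eq_iff)

lemma carrier_quotient_of_subgroup: "carrier (G\<lparr>carrier := H\<rparr> Mod A) = (\<lambda>h. A #>\<^bsub>G\<^esub> h) ` H"
  by (simp add: carrier_FactGroup r_coset_def)

lemma coset_map_group_hom:
  assumes "A \<lhd> G"
  shows "group_hom G (G Mod A) (\<lambda>g. A #>\<^bsub>G\<^esub> g)"
proof -
  interpret normal A G by fact
  show ?thesis
    by (simp add: group_hom_def group_hom_axioms_def factorgroup_is_group r_coset_hom_Mod is_group)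
qed

lemma coset_mem_quotient_iff:
  assumes "A \<lhd> G" and "subgroup H G" and "A \<subseteq> H" and "g \<in> carrier G"
  shows "A #>\<^bsub>G\<^esub> g \<in> carrier (G\<lparr>carrier := H\<rparr> Mod A) \<longleftrightarrow> g \<in> H"
proof
  interpret normal A G by fact
  assume "A #>\<^bsub>G\<^esub> g \<in> carrier (G\<lparr>carrier := H\<rparr> Mod A)"
  then obtain h where h: "h \<in> H" "A #>\<^bsub>G\<^esub> g = A #>\<^bsub>G\<^esub> h"
    by (auto simp: carrier_quotient_of_subgroup)
  then have "g \<in> A #>\<^bsub>G\<^esub> h"
    using rcos_self[OF assms(4) is_subgroup] by simp
  then show "g \<in> H"
    using h assms(2,3) by (auto simp: r_coset_def intro: subgroup.m_closed)
qed (auto simp: carrier_quotient_of_subgroup)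

lemma sum_over_cosets:
  fixes F :: "'a set \<Rightarrow> complex"
  assumes "A \<lhd> G" and "finite (carrier G)"
  shows "(\<Sum>g\<in>carrier G. F (A #>\<^bsub>G\<^esub> g)) = of_nat (card A) * (\<Sum>C\<in>carrier (G Mod A). F C)"
proof -
  interpret normal A G by fact
  have fibre: "{g \<in> carrier G. A #>\<^bsub>G\<^esub> g = A #>\<^bsub>G\<^esub> x} = A #>\<^bsub>G\<^esub> x" if "x \<in> carrier G" for x
    using that rcos_self[OF _ is_subgroup] repr_independence[OF _ _ is_subgroup]
      r_coset_subset_G[OF subset] by blast
  have card: "card (A #>\<^bsub>G\<^esub> x) = card A" if "x \<in> carrier G" for x
    using that by (intro card_rcosets_equal[symmetric] subset) (auto simp: RCOSETS_def)
  have "(\<Sum>g\<in>carrier G. F (A #>\<^bsub>G\<^esub> g))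
      = (\<Sum>C\<in>carrier (G Mod A). \<Sum>g\<in>{g \<in> carrier G. A #>\<^bsub>G\<^esub> g = C}. F (A #>\<^bsub>G\<^esub> g))"
    unfolding carrier_FactGroup by (rule sum.image_gen) fact
  also have "\<dots> = (\<Sum>C\<in>carrier (G Mod A). of_nat (card A) * F C)"
  proof (rule sum.cong)
    fix C assume "C \<in> carrier (G Mod A)"
    then obtain x where x: "x \<in> carrier G" "C = A #>\<^bsub>G\<^esub> x"
      by (auto simp: carrier_FactGroup)
    have "(\<Sum>g\<in>{g \<in> carrier G. A #>\<^bsub>G\<^esub> g = C}. F (A #>\<^bsub>G\<^esub> g)) = (\<Sum>g\<in>{g \<in> carrier G. A #>\<^bsub>G\<^esub> g = C}. F C)"
      by (rule sum.cong) auto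
    then show "(\<Sum>g\<in>{g \<in> carrier G. A #>\<^bsub>G\<^esub> g = C}. F (A #>\<^bsub>G\<^esub> g)) = of_nat (card A) * F C"
      using x fibre card by simp
  qed simp
  finally show ?thesis
    by (simp add: sum_distrib_left)
qed

definition inflate ::
    "('a, 'b) monoid_scheme \<Rightarrow> 'a set \<Rightarrow> ('a set \<Rightarrow> complex) \<Rightarrow> 'a \<Rightarrow> complex"
  where "inflate G A \<chi> = (\<lambda>g\<in>carrier G. \<chi> (A #>\<^bsub>G\<^esub> g))"

lemma inflate_apply [simp]: "g \<in> carrier G \<Longrightarrow> inflate G A \<chi> g = \<chi> (A #>\<^bsub>G\<^esub> g)"
  by (simp add: inflate_def)

lemma inflate_inject:
  assumes "\<chi> \<in> extensional (carrier (G Mod A))" and "\<phi> \<in> extensional (carrier (G Mod A))"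
    and "inflate G A \<chi> = inflate G A \<phi>"
  shows "\<chi> = \<phi>"
proof (rule extensionalityI[OF assms(1,2)])
  fix C assume "C \<in> carrier (G Mod A)"
  then obtain g where "g \<in> carrier G" "C = A #>\<^bsub>G\<^esub> g"
    by (auto simp: carrier_FactGroup)
  then show "\<chi> C = \<phi> C"
    using assms(3) by (metis inflate_apply)
qed

lemma Irr_extensional: "\<chi> \<in> Irr G \<Longrightarrow> \<chi> \<in> extensional (carrier G)"
  by (auto simp: Irr_def rep_character_def)

text \<open>The value of a character at the identity is the degree of the representation.\<close>

lemma Irr_one_nonzero:
  assumes "Group.group G" and "\<chi> \<in> Irr G"
  shows "\<chi> \<one>\<^bsub>G\<^esub> \<noteq> 0"
  using assms
  by (auto simp: Irr_def rep_character_def irreducible_rep_def matrix_representation_one group.is_monoid)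

text \<open>A representation that factors through the coset map has the same image, hence the same
  invariant subspaces, as the representation of the quotient.\<close>

lemma irreducible_rep_quotient_iff:
  assumes "matrix_representation G n \<rho>" and "matrix_representation (G Mod A) n \<sigma>"
    and "\<And>g. g \<in> carrier G \<Longrightarrow> \<rho> g = \<sigma> (A #>\<^bsub>G\<^esub> g)"
  shows "irreducible_rep G n \<rho> \<longleftrightarrow> irreducible_rep (G Mod A) n \<sigma>"
  using assms by (simp add: irreducible_rep_def carrier_FactGroup)

lemma rep_character_inflate:
  assumes "\<And>g. g \<in> carrier G \<Longrightarrow> \<rho> g = \<sigma> (A #>\<^bsub>G\<^esub> g)"
  shows "rep_character G n \<rho> = inflate G A (rep_character (G Mod A) n \<sigma>)"
  using assms by (auto simp: rep_character_def inflate_def carrier_FactGroup intro!: restrict_ext)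

lemma inflate_Irr:
  assumes "A \<lhd> G" and "\<chi> \<in> Irr (G Mod A)"
  shows "inflate G A \<chi> \<in> Irr G"
proof -
  obtain n \<sigma> where \<sigma>: "\<chi> = rep_character (G Mod A) n \<sigma>" "irreducible_rep (G Mod A) n \<sigma>"
    using assms(2) by (auto simp: Irr_def)
  define \<rho> where "\<rho> = \<sigma> \<circ> (\<lambda>g. A #>\<^bsub>G\<^esub> g)"
  have "\<rho> \<in> hom G (GL n)"
    unfolding \<rho>_def using \<sigma>(2) normal.r_coset_hom_Mod[OF assms(1)]
    by (intro hom_compose) (auto simp: irreducible_rep_def matrix_representation_def)
  then have "irreducible_rep G n \<rho>"
    using \<sigma>(2) irreducible_rep_quotient_iff[of G n \<rho> A \<sigma>]
    by (auto simp: irreducible_rep_def matrix_representation_def \<rho>_def)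
  moreover have "inflate G A \<chi> = rep_character G n \<rho>"
    unfolding \<sigma>(1) by (rule rep_character_inflate[symmetric]) (simp add: \<rho>_def)
  ultimately show ?thesis
    by (auto simp: Irr_def)
qed

section \<open>Irreducible characters and a normal subgroup\<close>

text \<open>The sum of \<open>\<rho>\<close> over \<open>A\<close> absorbs every \<open>\<rho> b\<close> with \<open>b \<in> A\<close>, so its columns are \<open>A\<close>-fixed.\<close>

lemma coset_sums_zero_of_no_fixed_vectors:
  assumes "A \<lhd> G" and "matrix_representation G n \<rho>" and "g \<in> carrier G"
    and fixed: "\<And>w. w \<in> carrier_vec n \<Longrightarrow> (\<And>b. b \<in> A \<Longrightarrow> \<rho> b *\<^sub>v w = w) \<Longrightarrow> w = 0\<^sub>v n"
  shows "(\<Sum>a\<in>A. rep_character G n \<rho> (a \<otimes>\<^bsub>G\<^esub> g)) = 0"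
proof -
  interpret normal A G by fact
  note rep = matrix_representation_carrier[OF assms(2)] matrix_representation_mult[OF assms(2)]
  have entry: "\<rho> (g \<otimes>\<^bsub>G\<^esub> h) $$ (i, j) = (\<Sum>k<n. \<rho> g $$ (i, k) * \<rho> h $$ (k, j))"
    if "g \<in> carrier G" "h \<in> carrier G" "i < n" "j < n" for g h i j
    using that rep(1)[of g] rep(1)[of h]
    by (simp add: rep(2) scalar_prod_def atLeast0LessThan)
  define E where "E = mat n n (\<lambda>(i, j). \<Sum>a\<in>A. \<rho> a $$ (i, j))"
  have E_fixed: "\<rho> b *\<^sub>v col E j = col E j" if b: "b \<in> A" and j: "j < n" for b j
  proof (rule eq_vecI)
    fix i assume "i < dim_vec (col E j)"
    then have i: "i < n" by (simp add: E_def)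
    have bc: "b \<in> carrier G" using b subset by blast
    have "(\<rho> b *\<^sub>v col E j) $ i = (\<Sum>k<n. \<rho> b $$ (i, k) * (\<Sum>a\<in>A. \<rho> a $$ (k, j)))"
      using i j rep(1)[OF bc] by (simp add: E_def scalar_prod_def atLeast0LessThan)
    also have "\<dots> = (\<Sum>a\<in>A. \<Sum>k<n. \<rho> b $$ (i, k) * \<rho> a $$ (k, j))"
      by (simp add: sum_distrib_left) (rule sum.swap)
    also have "\<dots> = (\<Sum>a\<in>A. \<rho> (b \<otimes>\<^bsub>G\<^esub> a) $$ (i, j))"
      using i j bc subset by (intro sum.cong) (auto simp: entry)
    also have "\<dots> = (\<Sum>a\<in>A. \<rho> a $$ (i, j))"
      by (rule sum.reindex_bij_witness[where i = "\<lambda>a. inv\<^bsub>G\<^esub> b \<otimes>\<^bsub>G\<^esub> a" and j = "\<lambda>a. b \<otimes>\<^bsub>G\<^esub> a"])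
        (use b subset in \<open>auto simp: m_assoc[symmetric]\<close>)
    finally show "(\<rho> b *\<^sub>v col E j) $ i = col E j $ i"
      using i j by (simp add: E_def)
  qed (use rep(1) b subset in \<open>auto simp: E_def\<close>)
  have E0: "(\<Sum>a\<in>A. \<rho> a $$ (i, j)) = 0" if "i < n" "j < n" for i j
  proof -
    have "col E j = 0\<^sub>v n"
      using E_fixed that by (intro fixed) (auto simp: E_def)
    then have "col E j $ i = 0" using that by simp
    then show ?thesis using that by (simp add: E_def)
  qed
  have "(\<Sum>a\<in>A. rep_character G n \<rho> (a \<otimes>\<^bsub>G\<^esub> g))
      = (\<Sum>a\<in>A. \<Sum>i<n. \<Sum>k<n. \<rho> a $$ (i, k) * \<rho> g $$ (k, i))"
    using assms(3) subset by (intro sum.cong) (auto simp: rep_character_def entry)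
  also have "\<dots> = (\<Sum>i<n. \<Sum>a\<in>A. \<Sum>k<n. \<rho> a $$ (i, k) * \<rho> g $$ (k, i))"
    by (rule sum.swap)
  also have "\<dots> = (\<Sum>i<n. \<Sum>k<n. \<Sum>a\<in>A. \<rho> a $$ (i, k) * \<rho> g $$ (k, i))"
    by (intro sum.cong refl sum.swap)
  also have "\<dots> = 0"
    by (simp add: E0 flip: sum_distrib_right)
  finally show ?thesis .
qed

text \<open>If \<open>w\<close> is fixed by \<open>A\<close>, then so is \<open>\<rho>(g) w\<close>, because \<open>a g = g (g\<^sup>-\<^sup>1 a g)\<close> and
  \<open>g\<^sup>-\<^sup>1 a g\<close> lies in \<open>A\<close> by normality.\<close>

lemma fixed_vectors_zero_or_all:
  assumes "A \<lhd> G" and "irreducible_rep G n \<rho>"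
  defines "W \<equiv> {w \<in> carrier_vec n. \<forall>a\<in>A. \<rho> a *\<^sub>v w = w}"
  shows "W = {0\<^sub>v n} \<or> W = carrier_vec n"
proof (rule irreducible_rep_invariant_cases[OF assms(2)])
  interpret normal A G by fact
  have mr: "matrix_representation G n \<rho>"
    using assms(2) by (simp add: irreducible_rep_def)
  note rep = matrix_representation_carrier[OF mr] matrix_representation_mult[OF mr]
  have repA: "\<rho> a \<in> carrier_mat n n" if "a \<in> A" for a
    using that subset rep(1) by blast
  show "W \<subseteq> carrier_vec n" by (auto simp: W_def)
  show "0\<^sub>v n \<in> W"
  proof -
    have "\<rho> a *\<^sub>v 0\<^sub>v n = 0\<^sub>v n" if "a \<in> A" for a
      using repA[OF that] by (intro eq_vecI) auto
    then show ?thesis by (simp add: W_def)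
  qed
  show "v + w \<in> W" if "v \<in> W" "w \<in> W" for v w
    using that unfolding W_def by (auto simp: mult_add_distrib_mat_vec[OF repA])
  show "c \<cdot>\<^sub>v w \<in> W" if "w \<in> W" for c w
    using that unfolding W_def by (auto simp: mult_mat_vec[OF repA])
  show "\<rho> g *\<^sub>v w \<in> W" if g: "g \<in> carrier G" and w: "w \<in> W" for g w
  proof -
    have "\<rho> a *\<^sub>v (\<rho> g *\<^sub>v w) = \<rho> g *\<^sub>v w" if a: "a \<in> A" for a
    proof -
      define b where "b = inv\<^bsub>G\<^esub> g \<otimes>\<^bsub>G\<^esub> a \<otimes>\<^bsub>G\<^esub> g"
      have b: "b \<in> A"
        unfolding b_def using a g by (rule inv_op_closed1[rotated])
      have ac: "a \<in> carrier G" and bc: "b \<in> carrier G"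
        using a b subset by auto
      have eq: "a \<otimes>\<^bsub>G\<^esub> g = g \<otimes>\<^bsub>G\<^esub> b"
        using ac g by (simp add: b_def m_assoc[symmetric])
      have "\<rho> a *\<^sub>v (\<rho> g *\<^sub>v w) = \<rho> (a \<otimes>\<^bsub>G\<^esub> g) *\<^sub>v w"
        using w by (simp add: rep(2)[OF ac g] W_def assoc_mult_mat_vec[OF rep(1)[OF ac] rep(1)[OF g]])
      also have "\<dots> = \<rho> g *\<^sub>v (\<rho> b *\<^sub>v w)"
        unfolding eq using w by (simp add: rep(2)[OF g bc] W_def assoc_mult_mat_vec[OF rep(1)[OF g] rep(1)[OF bc]])
      finally show ?thesis
        using b w by (simp add: W_def)
    qed
    then show ?thesis
      using w mult_mat_vec_carrier[OF rep(1)[OF g]] by (simp add: W_def)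
  qed
qed

lemma mat_fixing_all_vectors:
  fixes M :: "'a :: comm_semiring_1 mat"
  assumes "M \<in> carrier_mat n n" and "\<And>w. w \<in> carrier_vec n \<Longrightarrow> M *\<^sub>v w = w"
  shows "M = 1\<^sub>m n"
proof (rule eq_matI)
  fix i j assume "i < dim_row (1\<^sub>m n :: 'a mat)" "j < dim_col (1\<^sub>m n :: 'a mat)"
  then have ij: "i < n" "j < n" by simp_all
  have "M $$ (i, j) = (M *\<^sub>v unit_vec n j) $ i"
    using assms(1) ij by simp
  then show "M $$ (i, j) = 1\<^sub>m n $$ (i, j)"
    using assms(2) ij by simp
qed (use assms(1) in auto)

text \<open>The two cases are those of the \<open>A\<close>-fixed vectors: all or only zero. When \<open>A\<close> acts trivially, the
  universal property of the quotient group provides the representation of \<open>G/A\<close>.\<close>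

lemma Irr_inflated_or_coset_sums_zero:
  assumes "A \<lhd> G" and "\<chi> \<in> Irr G"
  shows "(\<exists>\<theta>\<in>Irr (G Mod A). \<chi> = inflate G A \<theta>) \<or>
    (\<forall>g\<in>carrier G. (\<Sum>a\<in>A. \<chi> (a \<otimes>\<^bsub>G\<^esub> g)) = 0)"
proof -
  interpret normal A G by fact
  obtain n \<rho> where \<rho>: "\<chi> = rep_character G n \<rho>" "irreducible_rep G n \<rho>"
    using assms(2) by (auto simp: Irr_def)
  have mr: "matrix_representation G n \<rho>"
    using \<rho>(2) by (simp add: irreducible_rep_def)
  define W where "W = {w \<in> carrier_vec n. \<forall>a\<in>A. \<rho> a *\<^sub>v w = w}"
  consider "W = {0\<^sub>v n}" | "W = carrier_vec n"
    using fixed_vectors_zero_or_all[OF assms(1) \<rho>(2)] by (auto simp: W_def)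
  then show ?thesis
  proof cases
    case 1
    then have "w = 0\<^sub>v n" if "w \<in> carrier_vec n" "\<And>b. b \<in> A \<Longrightarrow> \<rho> b *\<^sub>v w = w" for w
      using that by (auto simp: W_def)
    then show ?thesis
      unfolding \<rho>(1) using coset_sums_zero_of_no_fixed_vectors[OF assms(1) mr] by blast
  next
    case 2
    have triv: "\<rho> a = 1\<^sub>m n" if "a \<in> A" for a
      using that 2 subset matrix_representation_carrier[OF mr]
      by (intro mat_fixing_all_vectors) (auto simp: W_def)
    have const: "\<rho> x = \<rho> y"
      if xy: "x \<in> carrier G" "y \<in> carrier G" "A #>\<^bsub>G\<^esub> x = A #>\<^bsub>G\<^esub> y" for x y
    proof -
      obtain a where a: "a \<in> A" "x = a \<otimes>\<^bsub>G\<^esub> y"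
        using rcos_self[OF xy(1) is_subgroup] xy(3) by (auto simp: r_coset_def)
      then have "\<rho> x = \<rho> a * \<rho> y"
        using xy subset by (auto simp: matrix_representation_mult[OF mr])
      then show ?thesis
        using triv[OF a(1)] left_mult_one_mat[OF matrix_representation_carrier[OF mr xy(2)]] by simp
    qed
    obtain \<sigma> where \<sigma>: "\<sigma> \<in> hom (G Mod A) (GL n)"
        "\<And>x. x \<in> carrier G \<Longrightarrow> \<sigma> (A #>\<^bsub>G\<^esub> x) = \<rho> x"
      using FactGroup_universal[OF mr[unfolded matrix_representation_def] assms(1) const] by blast
    have "irreducible_rep (G Mod A) n \<sigma>"
      using irreducible_rep_quotient_iff[OF mr, of A \<sigma>] \<sigma> \<rho>(2)
      by (simp add: matrix_representation_def)
    moreover have "\<chi> = inflate G A (rep_character (G Mod A) n \<sigma>)"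
      unfolding \<rho>(1) using \<sigma>(2) by (intro rep_character_inflate) simp
    ultimately show ?thesis
      by (auto simp: Irr_def)
  qed
qed

section \<open>Inner products and induction under inflation\<close>

lemma card_quotient:
  assumes "A \<lhd> G" and "finite (carrier G)"
  shows "card A * card (carrier (G Mod A)) = card (carrier G)"
  using group.lagrange[OF normal.axioms(2)[OF assms(1)] normal_imp_subgroup[OF assms(1)]]
  by (simp add: FactGroup_def Coset.order_def mult.commute)

lemma normal_card_nonzero:
  assumes "A \<lhd> G" and "finite (carrier G)"
  shows "card A \<noteq> 0"
  using card_quotient[OF assms] assms(2)
    monoid.one_closed[OF group.is_monoid[OF normal.axioms(2)[OF assms(1)]]]
  by (metis card_0_eq empty_iff mult_0)

lemma char_inner_inflate:
  assumes "A \<lhd> G" and "finite (carrier G)"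
  shows "char_inner G (inflate G A \<phi>) (inflate G A \<theta>) = char_inner (G Mod A) \<phi> \<theta>"
proof -
  have "(\<Sum>g\<in>carrier G. inflate G A \<phi> g * cnj (inflate G A \<theta> g))
      = of_nat (card A) * (\<Sum>C\<in>carrier (G Mod A). \<phi> C * cnj (\<theta> C))"
    using sum_over_cosets[OF assms, of "\<lambda>C. \<phi> C * cnj (\<theta> C)"] by simp
  then show ?thesis
    using normal_card_nonzero[OF assms]
    by (simp add: char_inner_def card_quotient[OF assms, symmetric])
qed

lemma inflate_mem_constituents_iff:
  assumes "A \<lhd> G" and "finite (carrier G)" and "\<phi> \<in> Irr (G Mod A)"
  shows "inflate G A \<phi> \<in> constituents G (inflate G A \<theta>) \<longleftrightarrow> \<phi> \<in> constituents (G Mod A) \<theta>"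
  using assms by (simp add: constituents_def char_inner_inflate inflate_Irr)

text \<open>The sum defining the induced character of \<open>G/A\<close> has one term where that of \<open>G\<close> has \<open>card A\<close>
  equal ones, and it is divided by \<open>card (H/A) = card H / card A\<close>: the two factors \<open>card A\<close> cancel.\<close>

lemma induced_inflate:
  assumes "A \<lhd> G" and "finite (carrier G)" and "subgroup H G" and "A \<subseteq> H"
  shows "induced G H (inflate (G\<lparr>carrier := H\<rparr>) A \<theta>)
    = inflate G A (induced (G Mod A) (carrier (G\<lparr>carrier := H\<rparr> Mod A)) \<theta>)" (is "?L = inflate G A ?R")
proof (rule extensionalityI[where A = "carrier G"])
  interpret normal A G by fact
  interpret \<pi>: group_hom G "G Mod A" "\<lambda>g. A #>\<^bsub>G\<^esub> g"
    using assms(1) by (rule coset_map_group_hom)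
  let ?K = "carrier (G\<lparr>carrier := H\<rparr> Mod A)"
  have AH: "A \<lhd> G\<lparr>carrier := H\<rparr>"
    using assms by (simp add: normal_restrict_supergroup)
  have finH: "finite H"
    using assms(2,3) finite_subset subgroup.subset by blast
  have cardH: "card H = card A * card ?K"
    using card_quotient[OF AH] finH by simp
  fix g assume g: "g \<in> carrier G"
  let ?F = "\<lambda>C. let y = C \<otimes>\<^bsub>G Mod A\<^esub> (A #>\<^bsub>G\<^esub> g) \<otimes>\<^bsub>G Mod A\<^esub> inv\<^bsub>G Mod A\<^esub> C
    in if y \<in> ?K then \<theta> y else 0"
  have "?L g = (\<Sum>x\<in>carrier G. ?F (A #>\<^bsub>G\<^esub> x)) / of_nat (card H)"
  proof -
    have "(let y = x \<otimes>\<^bsub>G\<^esub> g \<otimes>\<^bsub>G\<^esub> inv\<^bsub>G\<^esub> x in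
        if y \<in> H then inflate (G\<lparr>carrier := H\<rparr>) A \<theta> y else 0) = ?F (A #>\<^bsub>G\<^esub> x)"
      if x: "x \<in> carrier G" for x
    proof -
      define y where "y = x \<otimes>\<^bsub>G\<^esub> g \<otimes>\<^bsub>G\<^esub> inv\<^bsub>G\<^esub> x"
      have y: "y \<in> carrier G" using x g by (simp add: y_def)
      have "(A #>\<^bsub>G\<^esub> x) \<otimes>\<^bsub>G Mod A\<^esub> (A #>\<^bsub>G\<^esub> g) \<otimes>\<^bsub>G Mod A\<^esub> inv\<^bsub>G Mod A\<^esub> (A #>\<^bsub>G\<^esub> x) = A #>\<^bsub>G\<^esub> y"
        using x g by (simp add: y_def del: mult_FactGroup flip: \<pi>.hom_mult \<pi>.hom_inv)
      moreover have "A #>\<^bsub>G\<lparr>carrier := H\<rparr>\<^esub> y = A #>\<^bsub>G\<^esub> y"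
        by (simp add: r_coset_def)
      ultimately show ?thesis
        using coset_mem_quotient_iff[OF assms(1,3,4) y]
        by (simp add: Let_def inflate_def del: mult_FactGroup flip: y_def)
    qed
    then show ?thesis
      using g by (simp add: induced_def)
  qed
  also have "\<dots> = (\<Sum>C\<in>carrier (G Mod A). ?F C) / of_nat (card ?K)"
    unfolding sum_over_cosets[OF assms(1,2), of ?F] cardH
    using normal_card_nonzero[OF assms(1,2)] by simp
  also have "\<dots> = ?R (A #>\<^bsub>G\<^esub> g)"
    using \<pi>.hom_closed[OF g] by (simp add: induced_def)
  finally show "?L g = inflate G A ?R g"
    using g by simp
qed (auto simp: induced_def inflate_def)

text \<open>In an inner product, a function that is constant on cosets only sees the coset sums of the other factor.\<close>

lemma char_inner_inflate_coset_sums_zero: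
  assumes "A \<lhd> G" and "finite (carrier G)"
    and zero: "\<And>g. g \<in> carrier G \<Longrightarrow> (\<Sum>a\<in>A. \<theta> (a \<otimes>\<^bsub>G\<^esub> g)) = 0"
  shows "char_inner G (inflate G A \<chi>) \<theta> = 0"
proof -
  interpret normal A G by fact
  let ?S = "\<Sum>g\<in>carrier G. inflate G A \<chi> g * cnj (\<theta> g)"
  have translate: "?S = (\<Sum>g\<in>carrier G. \<chi> (A #>\<^bsub>G\<^esub> g) * cnj (\<theta> (a \<otimes>\<^bsub>G\<^esub> g)))" if a: "a \<in> A" for a
  proof -
    have ac: "a \<in> carrier G" using a subset by blast
    have same_coset: "A #>\<^bsub>G\<^esub> (a \<otimes>\<^bsub>G\<^esub> g) = A #>\<^bsub>G\<^esub> g" if "g \<in> carrier G" for g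
      using that a ac subset is_group by (simp add: coset_mult_assoc[symmetric] rcos_const)
    have "(\<Sum>g\<in>carrier G. \<chi> (A #>\<^bsub>G\<^esub> g) * cnj (\<theta> (a \<otimes>\<^bsub>G\<^esub> g))) = ?S"
    proof (rule sum.reindex_bij_witness[where i = "\<lambda>g. inv\<^bsub>G\<^esub> a \<otimes>\<^bsub>G\<^esub> g" and j = "\<lambda>g. a \<otimes>\<^bsub>G\<^esub> g"])
      fix g assume g: "g \<in> carrier G"
      show "inv\<^bsub>G\<^esub> a \<otimes>\<^bsub>G\<^esub> (a \<otimes>\<^bsub>G\<^esub> g) = g" "a \<otimes>\<^bsub>G\<^esub> (inv\<^bsub>G\<^esub> a \<otimes>\<^bsub>G\<^esub> g) = g"
        using ac g by (simp_all flip: m_assoc)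
      show "a \<otimes>\<^bsub>G\<^esub> g \<in> carrier G" "inv\<^bsub>G\<^esub> a \<otimes>\<^bsub>G\<^esub> g \<in> carrier G"
        using ac g by simp_all
      show "inflate G A \<chi> (a \<otimes>\<^bsub>G\<^esub> g) * cnj (\<theta> (a \<otimes>\<^bsub>G\<^esub> g)) = \<chi> (A #>\<^bsub>G\<^esub> g) * cnj (\<theta> (a \<otimes>\<^bsub>G\<^esub> g))"
        using ac g same_coset by simp
    qed
    then show ?thesis by simp
  qed
  have "of_nat (card A) * ?S = (\<Sum>a\<in>A. \<Sum>g\<in>carrier G. \<chi> (A #>\<^bsub>G\<^esub> g) * cnj (\<theta> (a \<otimes>\<^bsub>G\<^esub> g)))"
    by (simp flip: translate)
  also have "\<dots> = (\<Sum>g\<in>carrier G. \<chi> (A #>\<^bsub>G\<^esub> g) * cnj (\<Sum>a\<in>A. \<theta> (a \<otimes>\<^bsub>G\<^esub> g)))"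
    by (subst sum.swap) (simp add: sum_distrib_left)
  also have "\<dots> = 0"
    by (simp add: zero del: cnj_sum)
  finally show ?thesis
    using normal_card_nonzero[OF assms(1,2)] by (simp add: char_inner_def)
qed

text \<open>Conjugation by \<open>x\<close> permutes \<open>A\<close>, so the terms of the induced character that belong to \<open>x\<close> add
  up over \<open>A g\<close> to a coset sum of \<open>\<psi>\<close>, or to zero when the conjugated coset lies outside \<open>H\<close>.\<close>

lemma induced_coset_sums_zero:
  assumes "A \<lhd> G" and "subgroup H G" and "A \<subseteq> H"
    and zero: "\<And>h. h \<in> H \<Longrightarrow> (\<Sum>a\<in>A. \<psi> (a \<otimes>\<^bsub>G\<^esub> h)) = 0" and g: "g \<in> carrier G"
  shows "(\<Sum>a\<in>A. induced G H \<psi> (a \<otimes>\<^bsub>G\<^esub> g)) = 0"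
proof -
  interpret normal A G by fact
  define f where "f y = (if y \<in> H then \<psi> y else 0)" for y
  have inner: "(\<Sum>a\<in>A. f (x \<otimes>\<^bsub>G\<^esub> (a \<otimes>\<^bsub>G\<^esub> g) \<otimes>\<^bsub>G\<^esub> inv\<^bsub>G\<^esub> x)) = 0" if x: "x \<in> carrier G" for x
  proof -
    define y where "y = x \<otimes>\<^bsub>G\<^esub> g \<otimes>\<^bsub>G\<^esub> inv\<^bsub>G\<^esub> x"
    have y: "y \<in> carrier G" using x g by (simp add: y_def)
    have "(\<Sum>a\<in>A. f (x \<otimes>\<^bsub>G\<^esub> (a \<otimes>\<^bsub>G\<^esub> g) \<otimes>\<^bsub>G\<^esub> inv\<^bsub>G\<^esub> x)) = (\<Sum>a\<in>A. f (a \<otimes>\<^bsub>G\<^esub> y))"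
    proof (rule sum.reindex_bij_witness[where i = "\<lambda>a. inv\<^bsub>G\<^esub> x \<otimes>\<^bsub>G\<^esub> a \<otimes>\<^bsub>G\<^esub> x"
          and j = "\<lambda>a. x \<otimes>\<^bsub>G\<^esub> a \<otimes>\<^bsub>G\<^esub> inv\<^bsub>G\<^esub> x"])
      fix a assume a: "a \<in> A"
      then have ac: "a \<in> carrier G" using subset by blast
      show "inv\<^bsub>G\<^esub> x \<otimes>\<^bsub>G\<^esub> (x \<otimes>\<^bsub>G\<^esub> a \<otimes>\<^bsub>G\<^esub> inv\<^bsub>G\<^esub> x) \<otimes>\<^bsub>G\<^esub> x = a"
        "x \<otimes>\<^bsub>G\<^esub> (inv\<^bsub>G\<^esub> x \<otimes>\<^bsub>G\<^esub> a \<otimes>\<^bsub>G\<^esub> x) \<otimes>\<^bsub>G\<^esub> inv\<^bsub>G\<^esub> x = a"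
        using x ac by (simp_all add: m_assoc) (simp_all flip: m_assoc)
      show "x \<otimes>\<^bsub>G\<^esub> a \<otimes>\<^bsub>G\<^esub> inv\<^bsub>G\<^esub> x \<in> A" "inv\<^bsub>G\<^esub> x \<otimes>\<^bsub>G\<^esub> a \<otimes>\<^bsub>G\<^esub> x \<in> A"
        using x a by (simp_all add: inv_op_closed1 inv_op_closed2)
      have "x \<otimes>\<^bsub>G\<^esub> a \<otimes>\<^bsub>G\<^esub> inv\<^bsub>G\<^esub> x \<otimes>\<^bsub>G\<^esub> y = x \<otimes>\<^bsub>G\<^esub> (a \<otimes>\<^bsub>G\<^esub> g) \<otimes>\<^bsub>G\<^esub> inv\<^bsub>G\<^esub> x"
        using x ac g by (simp add: y_def m_assoc) (simp flip: m_assoc)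
      then show "f (x \<otimes>\<^bsub>G\<^esub> a \<otimes>\<^bsub>G\<^esub> inv\<^bsub>G\<^esub> x \<otimes>\<^bsub>G\<^esub> y) = f (x \<otimes>\<^bsub>G\<^esub> (a \<otimes>\<^bsub>G\<^esub> g) \<otimes>\<^bsub>G\<^esub> inv\<^bsub>G\<^esub> x)"
        by simp
    qed
    also have "\<dots> = 0"
    proof (cases "y \<in> H")
      case True
      then have "(\<Sum>a\<in>A. f (a \<otimes>\<^bsub>G\<^esub> y)) = (\<Sum>a\<in>A. \<psi> (a \<otimes>\<^bsub>G\<^esub> y))"
        using assms(2,3) by (intro sum.cong) (auto simp: f_def intro: subgroup.m_closed)
      then show ?thesis using zero[OF True] by simp
    next
      case False
      have "a \<otimes>\<^bsub>G\<^esub> y \<notin> H" if "a \<in> A" for a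
      proof
        assume H: "a \<otimes>\<^bsub>G\<^esub> y \<in> H"
        have "inv\<^bsub>G\<^esub> a \<in> H" using that assms(2,3) by (auto intro: subgroup.m_inv_closed)
        then have "inv\<^bsub>G\<^esub> a \<otimes>\<^bsub>G\<^esub> (a \<otimes>\<^bsub>G\<^esub> y) \<in> H"
          using H assms(2) by (blast intro: subgroup.m_closed)
        then show False
          using False that subset y by (auto simp flip: m_assoc)
      qed
      then show ?thesis by (simp add: f_def)
    qed
    finally show ?thesis .
  qed
  have "(\<Sum>a\<in>A. induced G H \<psi> (a \<otimes>\<^bsub>G\<^esub> g))
      = (\<Sum>a\<in>A. (\<Sum>x\<in>carrier G. f (x \<otimes>\<^bsub>G\<^esub> (a \<otimes>\<^bsub>G\<^esub> g) \<otimes>\<^bsub>G\<^esub> inv\<^bsub>G\<^esub> x)) / of_nat (card H))"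
    using subset g by (intro sum.cong) (auto simp: induced_def f_def Let_def)
  also have "\<dots> = (\<Sum>x\<in>carrier G. \<Sum>a\<in>A. f (x \<otimes>\<^bsub>G\<^esub> (a \<otimes>\<^bsub>G\<^esub> g) \<otimes>\<^bsub>G\<^esub> inv\<^bsub>G\<^esub> x)) / of_nat (card H)"
    by (subst sum.swap) (simp flip: sum_divide_distrib)
  also have "\<dots> = 0" by (simp add: inner)
  finally show ?thesis .
qed

section \<open>Descending the inducing character to the quotient\<close>

text \<open>If \<open>\<psi>\<close> is not inflated, the induced character is orthogonal to all inflated ones.\<close>

lemma inducing_character_inflated:
  assumes "A \<lhd> G" and "finite (carrier G)" and "subgroup H G" and "A \<subseteq> H"
    and "\<psi> \<in> Irr (G\<lparr>carrier := H\<rparr>)"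
    and "inflate G A \<chi> \<in> constituents G (induced G H \<psi>)"
  shows "\<exists>\<theta>\<in>Irr (G\<lparr>carrier := H\<rparr> Mod A). \<psi> = inflate (G\<lparr>carrier := H\<rparr>) A \<theta>"
proof (rule ccontr)
  interpret normal A G by fact
  have AH: "A \<lhd> G\<lparr>carrier := H\<rparr>"
    using assms by (simp add: normal_restrict_supergroup)
  assume "\<not> ?thesis"
  then have "(\<Sum>a\<in>A. \<psi> (a \<otimes>\<^bsub>G\<^esub> h)) = 0" if "h \<in> H" for h
    using Irr_inflated_or_coset_sums_zero[OF AH assms(5)] that by auto
  then have "char_inner G (inflate G A \<chi>) (induced G H \<psi>) = 0"
    using assms(1-4) by (intro char_inner_inflate_coset_sums_zero induced_coset_sums_zero)
  then show False
    using assms(6) by (simp add: constituents_def)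
qed

text \<open>The irreducible representation of \<open>N\<close> that affords the restriction has no given relation to one
  that affords \<open>\<theta>\<close>, so the dichotomy is applied to \<open>N\<close> anew. The sum over \<open>A\<close> itself, which is
  \<open>card A\<close> times the degree, rules out vanishing coset sums.\<close>

lemma restrict_inflated_Irr:
  assumes "A \<lhd> G" and "finite (carrier G)" and "subgroup N G" and "A \<subseteq> N" and "N \<subseteq> H"
    and "subgroup H G" and "\<theta> \<in> Irr (G\<lparr>carrier := H\<rparr> Mod A)"
    and "restrict (inflate (G\<lparr>carrier := H\<rparr>) A \<theta>) N \<in> Irr (G\<lparr>carrier := N\<rparr>)" (is "?\<psi> \<in> _")
  shows "restrict \<theta> (carrier (G\<lparr>carrier := N\<rparr> Mod A)) \<in> Irr (G\<lparr>carrier := N\<rparr> Mod A)"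
proof -
  interpret normal A G by fact
  have AN: "A \<lhd> G\<lparr>carrier := N\<rparr>" and AH: "A \<lhd> G\<lparr>carrier := H\<rparr>"
    using assms by (simp_all add: normal_restrict_supergroup)
  have coset: "B #>\<^bsub>G\<lparr>carrier := K\<rparr>\<^esub> x = B #>\<^bsub>G\<^esub> x" for B K x
    by (simp add: r_coset_def)
  have \<psi>: "?\<psi> n = \<theta> (A #>\<^bsub>G\<^esub> n)" if "n \<in> N" for n
    using that assms(5) by (auto simp: coset)
  have sum_A: "(\<Sum>a\<in>A. ?\<psi> (a \<otimes>\<^bsub>G\<^esub> \<one>\<^bsub>G\<^esub>)) \<noteq> 0"
  proof -
    have "?\<psi> (a \<otimes>\<^bsub>G\<^esub> \<one>\<^bsub>G\<^esub>) = \<theta> A" if "a \<in> A" for a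
      using that assms(4) subset \<psi>[of a] is_group by (auto simp: rcos_const)
    moreover have "\<theta> A \<noteq> 0"
      using Irr_one_nonzero[OF normal.factorgroup_is_group[OF AH] assms(7)] by simp
    ultimately show ?thesis
      using normal_card_nonzero[OF assms(1,2)] by simp
  qed
  have "\<not> (\<forall>g\<in>carrier (G\<lparr>carrier := N\<rparr>). (\<Sum>a\<in>A. ?\<psi> (a \<otimes>\<^bsub>G\<lparr>carrier := N\<rparr>\<^esub> g)) = 0)"
    by (rule notI, drule bspec[where x = "\<one>\<^bsub>G\<^esub>"])
      (use sum_A subgroup.one_closed[OF assms(3)] in \<open>simp_all del: restrict_apply\<close>)
  then obtain \<tau> where \<tau>: "\<tau> \<in> Irr (G\<lparr>carrier := N\<rparr> Mod A)" "?\<psi> = inflate (G\<lparr>carrier := N\<rparr>) A \<tau>"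
    using Irr_inflated_or_coset_sums_zero[OF AN assms(8)] by blast
  have "restrict \<theta> (carrier (G\<lparr>carrier := N\<rparr> Mod A)) = \<tau>"
  proof (rule inflate_inject[where G = "G\<lparr>carrier := N\<rparr>"])
    show "inflate (G\<lparr>carrier := N\<rparr>) A (restrict \<theta> (carrier (G\<lparr>carrier := N\<rparr> Mod A)))
        = inflate (G\<lparr>carrier := N\<rparr>) A \<tau>"
      unfolding \<tau>(2)[symmetric] using assms(5)
      by (auto simp: inflate_def coset carrier_quotient_of_subgroup intro!: ext)
  qed (use Irr_extensional[OF \<tau>(1)] in auto)
  then show ?thesis
    using \<tau>(1) by simp
qed

theorem theorem4p7:
  fixes G :: "('a, 'b) monoid_scheme" and N A :: "'a set"
  assumes "group G" and "finite (carrier G)" and "N \<lhd> G"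
    and "relative_almost_monomial G N"
    and "A \<lhd> G" and "A \<subseteq> N"
  shows "relative_almost_monomial (G Mod A) (carrier (G\<lparr>carrier := N\<rparr> Mod A))"
proof -
  interpret \<pi>: group_hom G "G Mod A" "\<lambda>g. A #>\<^bsub>G\<^esub> g"
    using assms(5) by (rule coset_map_group_hom)
  let ?Q = "\<lambda>H. carrier (G\<lparr>carrier := H\<rparr> Mod A)"
  have "\<exists>K \<theta>. subgroup K (G Mod A) \<and> ?Q N \<subseteq> K \<and> \<theta> \<in> Irr ((G Mod A)\<lparr>carrier := K\<rparr>) \<and>
      restrict \<theta> (?Q N) \<in> Irr ((G Mod A)\<lparr>carrier := ?Q N\<rparr>) \<and>
      \<chi> \<in> constituents (G Mod A) (induced (G Mod A) K \<theta>) \<and>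
      \<phi> \<notin> constituents (G Mod A) (induced (G Mod A) K \<theta>)"
    if \<chi>: "\<chi> \<in> Irr (G Mod A)" and \<phi>: "\<phi> \<in> Irr (G Mod A)" and ne: "\<chi> \<noteq> \<phi>" for \<chi> \<phi>
  proof -
    have "inflate G A \<chi> \<noteq> inflate G A \<phi>"
      using inflate_inject[OF Irr_extensional[OF \<chi>] Irr_extensional[OF \<phi>]] ne by blast
    then obtain H \<psi> where H: "subgroup H G" "N \<subseteq> H" and \<psi>: "\<psi> \<in> Irr (G\<lparr>carrier := H\<rparr>)"
      "restrict \<psi> N \<in> Irr (G\<lparr>carrier := N\<rparr>)"
      and cons: "inflate G A \<chi> \<in> constituents G (induced G H \<psi>)"
        "inflate G A \<phi> \<notin> constituents G (induced G H \<psi>)"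
      using assms(4) inflate_Irr[OF assms(5) \<chi>] inflate_Irr[OF assms(5) \<phi>]
      unfolding relative_almost_monomial_def by blast
    have AH: "A \<subseteq> H" using assms(6) H(2) by blast
    obtain \<theta> where \<theta>: "\<theta> \<in> Irr (G\<lparr>carrier := H\<rparr> Mod A)" "\<psi> = inflate (G\<lparr>carrier := H\<rparr>) A \<theta>"
      using inducing_character_inflated[OF assms(5,2) H(1) AH \<psi>(1) cons(1)] by blast
    have "subgroup (?Q H) (G Mod A)"
      unfolding carrier_quotient_of_subgroup by (rule \<pi>.subgroup_img_is_subgroup[OF H(1)])
    moreover have "?Q N \<subseteq> ?Q H"
      using H(2) by (auto simp: carrier_quotient_of_subgroup)
    moreover have "\<theta> \<in> Irr ((G Mod A)\<lparr>carrier := ?Q H\<rparr>)"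
      using \<theta>(1) by (simp add: quotient_of_subgroup)
    moreover have "restrict \<theta> (?Q N) \<in> Irr ((G Mod A)\<lparr>carrier := ?Q N\<rparr>)"
      unfolding quotient_of_subgroup
      using restrict_inflated_Irr[OF assms(5,2) normal_imp_subgroup[OF assms(3)] assms(6) H(2,1) \<theta>(1)]
        \<psi>(2) \<theta>(2) by simp
    moreover have "\<chi> \<in> constituents (G Mod A) (induced (G Mod A) (?Q H) \<theta>)"
      "\<phi> \<notin> constituents (G Mod A) (induced (G Mod A) (?Q H) \<theta>)"
      using cons inflate_mem_constituents_iff[OF assms(5,2)] \<chi> \<phi>
      unfolding \<theta>(2) induced_inflate[OF assms(5,2) H(1) AH] by blast+
    ultimately show ?thesis by blast
  qed
  moreover have "?Q N \<lhd> G Mod A"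
    unfolding carrier_quotient_of_subgroup
    by (rule normal.surj_hom_normal_subgroup[OF assms(3) \<pi>.group_hom_axioms])
      (simp add: carrier_FactGroup)
  moreover have "finite (carrier (G Mod A))"
    using assms(2) by (simp add: carrier_FactGroup)
  ultimately show ?thesis
    unfolding relative_almost_monomial_def by blast
qed

end
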